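(* Let $X$ be a Banach space, let $-\infty<a<b<\infty$, and let $F:[a,b]\to L(X)$ be of bounded variation on $[a,b]$. Let $g:[a,b]\to X$ be a regulated function and $\{g_n\}_{n\in\mathbb N}$ a sequence of regulated functions $g_n:[a,b]\to X$ such that $$\lim_{n\to\infty}g_n(t)=g(t)\ \text{ in } X\quad\text{for every } t\in[a,b],$$ and such that there is a constant $K<\infty$ with $$\|g_n\|_\infty\le K\quad\text{for all } n\in\mathbb N .$$ Then the Kurzweil-Stieltjes integrals $\int_a^b \mathrm d[F]\,g$ and $\int_a^b \mathrm d[F]\,g_n$ exist for all $n\in\mathbb N$, and $$\lim_{n\to\infty}\int_a^b \mathrm d[F]\,g_n=\int_a^b \mathrm d[F]\,g .$$
   Context: $L(X)$ is the Banach space of bounded linear operators on $X$ with the operator norm. For a function $f:[a,b]\to Y$ into a Banach space $Y$: $\|f\|_\infty=\sup_{t\in[a,b]}\|f(t)\|_Y$; $f$ is of bounded variation if $\mathrm{var}_a^b f=\sup\sum_{j=1}^{m}\|f(\alpha_j)-f(\alpha_{j-1})\|_Y<\infty$, the supremum being over all divisions $a=\alpha_0<\alpha_1<\dots<\alpha_m=b$; $f$ is regulated if the one-sided limits $f(t+)$ for $t\in[a,b)$ and $f(t-)$ for $t\in(a,b]$ exist in norm. Kurzweil-Stieltjes integral: a tagged division of $[a,b]$ is $P=\{(\tau_j,[\alpha_{j-1},\alpha_j]):j=1,\dots,m\}$ with $a=\alpha_0<\dots<\alpha_m=b$ and $\tau_j\in[\alpha_{j-1},\alpha_j]$. A gauge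 is a function $\delta:[a,b]\to(0,\infty)$; $P$ is $\delta$-fine if $[\alpha_{j-1},\alpha_j]\subset(\tau_j-\delta(\tau_j),\tau_j+\delta(\tau_j))$ for all $j$. For $F:[a,b]\to L(X)$ and $g:[a,b]\to X$ put $S(\mathrm dF,g,P)=\sum_{j=1}^m[F(\alpha_j)-F(\alpha_{j-1})]g(\tau_j)$. Then $\int_a^b\mathrm d[F]\,g=J\in X$ means: for every $\varepsilon>0$ there is a gauge $\delta$ on $[a,b]$ such that $\|S(\mathrm dF,g,P)-J\|_X<\varepsilon$ for all $\delta$-fine tagged divisions $P$ of $[a,b]$. *)

theory Defs
  imports "HOL-Analysis.Analysis"
begin

text \<open>
  Functions on \<open>[a, b]\<close> are total functions on the reals; every notion below inspects their values
  on \<open>{a..b}\<close> only. A division \<open>a = \<alpha>\<^sub>0 < \<dots> < \<alpha>\<^sub>m = b\<close> is a pair \<open>m, \<alpha>\<close> with \<open>\<alpha>\<close> a sequence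
  whose values beyond \<open>m\<close> are ignored. Subintervals and tags are indexed from 0: \<open>\<tau> j\<close> is the tag of
  \<open>[\<alpha> j, \<alpha> (j + 1)]\<close> for \<open>j < m\<close>.
\<close>

definition is_division :: "real \<Rightarrow> real \<Rightarrow> nat \<Rightarrow> (nat \<Rightarrow> real) \<Rightarrow> bool" where
  "is_division a b m \<alpha> \<longleftrightarrow> \<alpha> 0 = a \<and> \<alpha> m = b \<and> (\<forall>j<m. \<alpha> j < \<alpha> (Suc j))"

definition variation :: "real \<Rightarrow> real \<Rightarrow> (real \<Rightarrow> 'a::real_normed_vector) \<Rightarrow> ereal" where
  "variation a b f =
    (SUP (m, \<alpha>) \<in> {(m, \<alpha>). is_division a b m \<alpha>}. ereal (\<Sum>j<m. norm (f (\<alpha> (Suc j)) - f (\<alpha> j))))"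

definition bounded_variation :: "real \<Rightarrow> real \<Rightarrow> (real \<Rightarrow> 'a::real_normed_vector) \<Rightarrow> bool" where
  "bounded_variation a b f \<longleftrightarrow> variation a b f < \<infinity>"

definition regulated :: "real \<Rightarrow> real \<Rightarrow> (real \<Rightarrow> 'a::real_normed_vector) \<Rightarrow> bool" where
  "regulated a b f \<longleftrightarrow>
    (\<forall>t\<in>{a..<b}. \<exists>l. (f \<longlongrightarrow> l) (at_right t)) \<and>
    (\<forall>t\<in>{a<..b}. \<exists>l. (f \<longlongrightarrow> l) (at_left t))"

text \<open>The supremum is taken in the extended reals, so that it is \<open>\<infinity>\<close> for unbounded \<open>f\<close>.\<close>

definition sup_norm :: "real \<Rightarrow> real \<Rightarrow> (real \<Rightarrow> 'a::real_normed_vector) \<Rightarrow> ereal" where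
  "sup_norm a b f = (SUP t\<in>{a..b}. ereal (norm (f t)))"

definition is_tagged_division ::
    "real \<Rightarrow> real \<Rightarrow> nat \<Rightarrow> (nat \<Rightarrow> real) \<Rightarrow> (nat \<Rightarrow> real) \<Rightarrow> bool" where
  "is_tagged_division a b m \<alpha> \<tau> \<longleftrightarrow>
    is_division a b m \<alpha> \<and> (\<forall>j<m. \<tau> j \<in> {\<alpha> j..\<alpha> (Suc j)})"

definition is_gauge :: "real \<Rightarrow> real \<Rightarrow> (real \<Rightarrow> real) \<Rightarrow> bool" where
  "is_gauge a b \<delta> \<longleftrightarrow> (\<forall>t\<in>{a..b}. 0 < \<delta> t)"

definition delta_fine :: "(real \<Rightarrow> real) \<Rightarrow> nat \<Rightarrow> (nat \<Rightarrow> real) \<Rightarrow> (nat \<Rightarrow> real) \<Rightarrow> bool" where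
  "delta_fine \<delta> m \<alpha> \<tau> \<longleftrightarrow>
    (\<forall>j<m. {\<alpha> j..\<alpha> (Suc j)} \<subseteq> {\<tau> j - \<delta> (\<tau> j)<..<\<tau> j + \<delta> (\<tau> j)})"

definition KS_sum ::
    "(real \<Rightarrow> 'a::real_normed_vector \<Rightarrow>\<^sub>L 'a) \<Rightarrow> (real \<Rightarrow> 'a) \<Rightarrow>
      nat \<Rightarrow> (nat \<Rightarrow> real) \<Rightarrow> (nat \<Rightarrow> real) \<Rightarrow> 'a" where
  "KS_sum F g m \<alpha> \<tau> = (\<Sum>j<m. blinfun_apply (F (\<alpha> (Suc j)) - F (\<alpha> j)) (g (\<tau> j)))"

definition has_KS_integral ::
    "real \<Rightarrow> real \<Rightarrow> (real \<Rightarrow> 'a::real_normed_vector \<Rightarrow>\<^sub>L 'a) \<Rightarrow> (real \<Rightarrow> 'a) \<Rightarrow> 'a \<Rightarrow> bool" where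
  "has_KS_integral a b F g J \<longleftrightarrow>
    (\<forall>\<epsilon>>0. \<exists>\<delta>. is_gauge a b \<delta> \<and>
      (\<forall>m \<alpha> \<tau>. is_tagged_division a b m \<alpha> \<tau> \<and> delta_fine \<delta> m \<alpha> \<tau> \<longrightarrow>
        norm (KS_sum F g m \<alpha> \<tau> - J) < \<epsilon>))"

definition KS_integrable ::
    "real \<Rightarrow> real \<Rightarrow> (real \<Rightarrow> 'a::real_normed_vector \<Rightarrow>\<^sub>L 'a) \<Rightarrow> (real \<Rightarrow> 'a) \<Rightarrow> bool" where
  "KS_integrable a b F g \<longleftrightarrow> (\<exists>J. has_KS_integral a b F g J)"

definition KS_integral ::
    "real \<Rightarrow> real \<Rightarrow> (real \<Rightarrow> 'a::real_normed_vector \<Rightarrow>\<^sub>L 'a) \<Rightarrow> (real \<Rightarrow> 'a) \<Rightarrow> 'a" where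
  "KS_integral a b F g = (THE J. has_KS_integral a b F g J)"

end

theory Submission
  imports Defs
begin

text \<open>
  The increments of \<open>F\<close> are dominated by those of its variation function \<open>v\<close>. Jump functions are
  integrable because a gauge can force the jump point to be a tag and \<open>F\<close> has one-sided limits; as
  regulated functions are uniform limits of step functions, they are integrable too. For the limit,
  the sets \<open>A k\<close> of points where \<open>\<parallel>g\<^sub>n - g\<parallel> \<ge> e\<close> for some \<open>n \<ge> k\<close> are Borel and decrease to the empty
  set. So their measure with respect to \<open>v\<close> tends to \<open>0\<close>, and by outer regularity some \<open>A N\<close> lies in
  an open set \<open>U\<close> of small measure. A gauge that keeps the intervals tagged in \<open>A N\<close> inside \<open>U\<close> makes
  their contribution to the sums for \<open>g\<^sub>n - g\<close> small for all \<open>n \<ge> N\<close> at once, while the other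
  intervals contribute at most \<open>e (v b - v a)\<close>.
\<close>

section \<open>Divisions and their extension by one point\<close>

lemma is_division_mono:
  assumes "is_division a b m \<alpha>" "i \<le> j" "j \<le> m"
  shows "\<alpha> i \<le> \<alpha> j"
  using assms(2,3)
proof (induction j rule: dec_induct)
  case (step k)
  with assms(1) have "\<alpha> k < \<alpha> (Suc k)"
    by (auto simp: is_division_def)
  with step show ?case by simp
qed simp

lemma is_division_in_interval:
  assumes "is_division a b m \<alpha>" "j \<le> m"
  shows "\<alpha> j \<in> {a..b}"
  using is_division_mono[OF assms(1), of 0 j] is_division_mono[OF assms(1), of j m] assms
  by (auto simp: is_division_def)

lemma is_tagged_division_tag_in_interval:
  assumes "is_tagged_division a b m \<alpha> \<tau>" "j < m"
  shows "\<tau> j \<in> {a..b}"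
  using assms is_division_in_interval[of a b m \<alpha> j] is_division_in_interval[of a b m \<alpha> "Suc j"]
  by (force simp: is_tagged_division_def)

lemma is_division_extend:
  assumes "is_division a s m \<alpha>" "s < t"
  shows "is_division a t (Suc m) (\<alpha>(Suc m := t))"
  using assms by (auto simp: is_division_def less_Suc_eq)

lemma is_tagged_division_extend:
  assumes "is_tagged_division a s m \<alpha> \<tau>" "s < t" "x \<in> {s..t}"
  shows "is_tagged_division a t (Suc m) (\<alpha>(Suc m := t)) (\<tau>(m := x))"
  using assms is_division_extend[of a s m \<alpha> t]
  by (auto simp: is_tagged_division_def is_division_def less_Suc_eq)

section \<open>The variation function as a dominating function\<close>

text \<open>Appending \<open>t\<close> to a division of \<open>[a, s]\<close> adds exactly the term
  \<open>norm (f t - f s)\<close>. This term is finite, so it may be moved across the inequality in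
  \<open>ereal\<close> before the supremum over the shorter divisions is taken.\<close>

lemma variation_superadditive:
  assumes "s \<le> t"
  shows "variation a s f + ereal (norm (f t - f s)) \<le> variation a t f"
proof (cases "s = t")
  case False
  have "variation a s f \<le> variation a t f - ereal (norm (f t - f s))"
    unfolding variation_def[of a s]
  proof (rule SUP_least, clarify)
    fix m \<alpha> assume div: "is_division a s m \<alpha>"
    let ?\<beta> = "\<alpha>(Suc m := t)"
    have "ereal (\<Sum>j<Suc m. norm (f (?\<beta> (Suc j)) - f (?\<beta> j))) \<le> variation a t f"
      unfolding variation_def using is_division_extend[OF div, of t] False assms
      by (intro SUP_upper2[of "(Suc m, ?\<beta>)"]) auto
    moreover have "(\<Sum>j<Suc m. norm (f (?\<beta> (Suc j)) - f (?\<beta> j)))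
        = (\<Sum>j<m. norm (f (\<alpha> (Suc j)) - f (\<alpha> j))) + norm (f t - f s)"
      using div by (simp add: is_division_def)
    ultimately show "ereal (\<Sum>j<m. norm (f (\<alpha> (Suc j)) - f (\<alpha> j)))
        \<le> variation a t f - ereal (norm (f t - f s))"
      by (simp add: ereal_le_minus)
  qed
  then show ?thesis by (simp add: ereal_le_minus)
qed simp

lemma variation_nonneg:
  assumes "a \<le> t"
  shows "0 \<le> variation a t f"
proof -
  \<comment> \<open>The division with \<open>m = 0\<close> and its empty sum keep the supremum from
    being taken over the empty set.\<close>
  have "0 \<le> variation a a f"
    unfolding variation_def
    by (intro SUP_upper2[of "(0, \<lambda>_. a)"]) (auto simp: is_division_def)
  also have "\<dots> \<le> variation a a f + ereal (norm (f t - f a))"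
    by (simp add: add_increasing2)
  also have "\<dots> \<le> variation a t f"
    by (rule variation_superadditive) fact
  finally show ?thesis .
qed

text \<open>The witness \<open>v u\<close> is the real value of \<open>variation a u f\<close>; it
  stays schematic until the last \<open>show\<close>. Superadditivity bounds each
  \<open>variation a u f\<close> by the one on \<open>[a, b]\<close>, so all values are finite and
  the inequality can be read in the reals.\<close>

lemma bounded_variation_dominated:
  fixes f :: "real \<Rightarrow> 'b::real_normed_vector"
  assumes "bounded_variation a b f"
  obtains v :: "real \<Rightarrow> real"
    where "\<And>s t. a \<le> s \<Longrightarrow> s \<le> t \<Longrightarrow> t \<le> b \<Longrightarrow> norm (f t - f s) \<le> v t - v s"
proof
  fix s t assume st: "a \<le> s" "s \<le> t" "t \<le> b"
  have fin: "\<bar>variation a u f\<bar> \<noteq> \<infinity>" if "a \<le> u" "u \<le> b" for u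
  proof -
    have "variation a u f \<le> variation a u f + ereal (norm (f b - f u))"
      by (simp add: add_increasing2)
    also have "\<dots> \<le> variation a b f"
      by (rule variation_superadditive) fact
    also have "\<dots> < \<infinity>"
      using assms by (simp add: bounded_variation_def)
    finally show ?thesis using variation_nonneg[OF that(1), of f] by auto
  qed
  obtain x y where "variation a s f = ereal x" "variation a t f = ereal y"
    using fin[of s] fin[of t] st by auto
  then show "norm (f t - f s) \<le> real_of_ereal (variation a t f) - real_of_ereal (variation a s f)"
    using variation_superadditive[OF st(2), of a f] by simp
qed

section \<open>The integral as a limit along a filter\<close>

text \<open>Filter generated by the sets of \<delta>-fine tagged divisions, a division being coded
  as a triple. Integrals become limits along it, so limit laws, uniqueness and the Cauchy criterion
  carry over.\<close>

definition KS_filter :: "real \<Rightarrow> real \<Rightarrow> (nat \<times> (nat \<Rightarrow> real) \<times> (nat \<Rightarrow> real)) filter" where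
  "KS_filter a b = (INF \<delta>\<in>{\<delta>. is_gauge a b \<delta>}.
     principal {(m, \<alpha>, \<tau>). is_tagged_division a b m \<alpha> \<tau> \<and> delta_fine \<delta> m \<alpha> \<tau>})"

lemma delta_fine_mono:
  assumes "delta_fine \<delta> m \<alpha> \<tau>" "\<And>t. \<delta> t \<le> \<delta>' t"
  shows "delta_fine \<delta>' m \<alpha> \<tau>"
  unfolding delta_fine_def
proof (intro allI impI subsetI)
  fix j x assume "j < m" "x \<in> {\<alpha> j..\<alpha> (Suc j)}"
  then have "x \<in> {\<tau> j - \<delta> (\<tau> j)<..<\<tau> j + \<delta> (\<tau> j)}"
    using assms(1) unfolding delta_fine_def by blast
  then show "x \<in> {\<tau> j - \<delta>' (\<tau> j)<..<\<tau> j + \<delta>' (\<tau> j)}"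
    using assms(2)[of "\<tau> j"] by auto
qed

text \<open>A single gauge suffices because the pointwise minimum of two gauges refines both, so the
  generating sets form a filter base.\<close>

lemma eventually_KS_filter:
  "eventually P (KS_filter a b) \<longleftrightarrow>
    (\<exists>\<delta>. is_gauge a b \<delta> \<and>
      (\<forall>m \<alpha> \<tau>. is_tagged_division a b m \<alpha> \<tau> \<and> delta_fine \<delta> m \<alpha> \<tau> \<longrightarrow> P (m, \<alpha>, \<tau>)))"
  unfolding KS_filter_def
proof (subst eventually_INF_base)
  show "{\<delta>. is_gauge a b \<delta>} \<noteq> {}"
    by (auto simp: is_gauge_def intro!: exI[of _ "\<lambda>_. 1"])
  fix \<delta> \<delta>' assume "\<delta> \<in> {\<delta>. is_gauge a b \<delta>}" "\<delta>' \<in> {\<delta>. is_gauge a b \<delta>}"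
  then show "\<exists>x\<in>{\<delta>. is_gauge a b \<delta>}.
      principal {(m, \<alpha>, \<tau>). is_tagged_division a b m \<alpha> \<tau> \<and> delta_fine x m \<alpha> \<tau>}
      \<le> inf (principal {(m, \<alpha>, \<tau>). is_tagged_division a b m \<alpha> \<tau> \<and> delta_fine \<delta> m \<alpha> \<tau>})
          (principal {(m, \<alpha>, \<tau>). is_tagged_division a b m \<alpha> \<tau> \<and> delta_fine \<delta>' m \<alpha> \<tau>})"
    by (intro bexI[of _ "\<lambda>t. min (\<delta> t) (\<delta>' t)"])
       (auto simp: is_gauge_def elim: delta_fine_mono)
qed (auto simp: eventually_principal)

lemma has_KS_integral_iff_tendsto:
  "has_KS_integral a b F g J \<longleftrightarrow>
    ((\<lambda>(m, \<alpha>, \<tau>). KS_sum F g m \<alpha> \<tau>) \<longlongrightarrow> J) (KS_filter a b)"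
  by (simp add: has_KS_integral_def tendsto_iff eventually_KS_filter dist_norm)

text \<open>Cousin's lemma, by bisection. The relation "\<open>Q s\<close> implies
  \<open>Q t\<close>" is transitive, and it holds on every interval around \<open>x\<close> shorter
  than \<open>\<delta> x\<close>, since that interval can be appended with tag
  \<open>x\<close>.\<close>

lemma delta_fine_division_exists:
  assumes "a \<le> b" "is_gauge a b \<delta>"
  shows "\<exists>m \<alpha> \<tau>. is_tagged_division a b m \<alpha> \<tau> \<and> delta_fine \<delta> m \<alpha> \<tau>"
proof -
  define Q where "Q t \<longleftrightarrow> (\<exists>m \<alpha> \<tau>. is_tagged_division a t m \<alpha> \<tau> \<and> delta_fine \<delta> m \<alpha> \<tau>)" for t
  have "Q a \<longrightarrow> Q b"
    using assms(1)
  proof (induction rule: Bolzano)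
    case (local x)
    then have "\<delta> x > 0" using assms(2) by (auto simp: is_gauge_def)
    moreover have "Q t" if "s \<le> x" "x \<le> t" "t - s < \<delta> x" "Q s" for s t
    proof (cases "s = t")
      case False
      obtain m \<alpha> \<tau> where *: "is_tagged_division a s m \<alpha> \<tau>" "delta_fine \<delta> m \<alpha> \<tau>"
        using \<open>Q s\<close> by (auto simp: Q_def)
      have "is_tagged_division a t (Suc m) (\<alpha>(Suc m := t)) (\<tau>(m := x))"
        using that False by (intro is_tagged_division_extend[OF *(1)]) auto
      moreover have "delta_fine \<delta> (Suc m) (\<alpha>(Suc m := t)) (\<tau>(m := x))"
        using * that by (auto simp: delta_fine_def less_Suc_eq is_tagged_division_def is_division_def)
      ultimately show ?thesis by (auto simp: Q_def)
    qed (use that in simp)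
    ultimately show ?case by blast
  qed blast
  moreover have "Q a"
    unfolding Q_def
    by (intro exI[of _ 0] exI[of _ "\<lambda>_. a"])
       (auto simp: is_tagged_division_def is_division_def delta_fine_def)
  ultimately show ?thesis by (simp add: Q_def)
qed

lemma KS_filter_neq_bot:
  assumes "a \<le> b"
  shows "KS_filter a b \<noteq> bot"
  using delta_fine_division_exists[OF assms]
  by (auto simp: trivial_limit_def eventually_KS_filter)

lemma KS_integral_eqI:
  assumes "a \<le> b" "has_KS_integral a b F g J"
  shows "KS_integral a b F g = J"
  unfolding KS_integral_def
  using assms tendsto_unique[OF KS_filter_neq_bot[OF assms(1)]]
  by (intro the_equality) (auto simp: has_KS_integral_iff_tendsto)

lemma KS_sum_add:
  "KS_sum F (\<lambda>t. g t + h t) m \<alpha> \<tau> = KS_sum F g m \<alpha> \<tau> + KS_sum F h m \<alpha> \<tau>"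
  by (simp add: KS_sum_def blinfun.add_right sum.distrib)

lemma KS_sum_diff:
  "KS_sum F (\<lambda>t. g t - h t) m \<alpha> \<tau> = KS_sum F g m \<alpha> \<tau> - KS_sum F h m \<alpha> \<tau>"
  by (simp add: KS_sum_def blinfun.diff_right sum_subtractf)

lemma has_KS_integral_add:
  assumes "has_KS_integral a b F g J" "has_KS_integral a b F h K"
  shows "has_KS_integral a b F (\<lambda>t. g t + h t) (J + K)"
  using tendsto_add[OF assms[unfolded has_KS_integral_iff_tendsto]]
  by (simp add: has_KS_integral_iff_tendsto KS_sum_add case_prod_unfold)

lemma has_KS_integral_diff:
  assumes "has_KS_integral a b F g J" "has_KS_integral a b F h K"
  shows "has_KS_integral a b F (\<lambda>t. g t - h t) (J - K)"
  using tendsto_diff[OF assms[unfolded has_KS_integral_iff_tendsto]]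
  by (simp add: has_KS_integral_iff_tendsto KS_sum_diff case_prod_unfold)

text \<open>Cauchy criterion along an arbitrary filter. It serves twice: for one-sided limits of
  \<open>F\<close> and for Kurzweil-Stieltjes sums.\<close>

lemma tendsto_of_cauchy:
  fixes f :: "'b \<Rightarrow> 'c::complete_space"
  assumes "G \<noteq> bot"
    and "\<And>e. e > 0 \<Longrightarrow> \<exists>P. eventually P G \<and> (\<forall>x y. P x \<and> P y \<longrightarrow> dist (f x) (f y) < e)"
  shows "\<exists>l. (f \<longlongrightarrow> l) G"
proof -
  have "cauchy_filter (filtermap f G)"
    using assms(2) by (simp add: cauchy_filter_metric_filtermap)
  moreover have "complete (UNIV :: 'c set)"
    by (meson Cauchy_convergent UNIV_I complete_def convergent_def)
  ultimately show ?thesis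
    using assms(1) complete_uniform[where S="UNIV :: 'c set"]
    by (force simp: filterlim_def filtermap_bot_iff)
qed

section \<open>Uniform approximation of regulated functions by step functions\<close>

text \<open>The approximant is a finite sum of jumps of the two kinds, so any property
  \<open>P\<close> of jumps that survives addition holds for it. Below, \<open>P\<close> is
  integrability or Borel measurability.\<close>

lemma regulated_approximation:
  fixes f :: "real \<Rightarrow> 'b::real_normed_vector"
  assumes "a \<le> b" "regulated a b f" "e > 0"
    and add: "\<And>h k. P h \<Longrightarrow> P k \<Longrightarrow> P (\<lambda>t. h t + k t)"
    and gt: "\<And>s x. s \<in> {a..b} \<Longrightarrow> P (\<lambda>t. if s < t then x else 0)"
    and ge: "\<And>s x. s \<in> {a..b} \<Longrightarrow> P (\<lambda>t. if s \<le> t then x else 0)"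
  obtains h where "P h" "\<And>t. t \<in> {a..b} \<Longrightarrow> norm (f t - h t) \<le> e"
proof -
  \<comment> \<open>\<open>Q c d\<close>: approximants that are constant from \<open>c\<close> on can be prolonged from \<open>[a, c]\<close> to \<open>[a, d]\<close>.
    In this form the property composes without any cutting and pasting of step functions.\<close>
  define Q where "Q c d \<longleftrightarrow> (a \<le> c \<longrightarrow> d \<le> b \<longrightarrow>
    (\<forall>h y. P h \<and> (\<forall>s\<ge>c. h s = y) \<longrightarrow>
      (\<exists>k z. P k \<and> (\<forall>s\<le>c. k s = h s) \<and> (\<forall>s. c < s \<and> s \<le> d \<longrightarrow> norm (f s - k s) \<le> e) \<and>
        (\<forall>s\<ge>d. k s = z))))" for c d
  have Q_refl: "Q c c" for c
    unfolding Q_def by (intro impI allI, rule_tac x = h in exI, rule_tac x = y in exI) auto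
  have Q_trans: "Q c e'" if Q: "Q c d" "Q d e'" "c \<le> d" "d \<le> e'" for c d e'
    unfolding Q_def
  proof (intro impI allI, elim conjE)
    fix h y assume A: "a \<le> c" "e' \<le> b" "P h" "\<forall>s\<ge>c. h s = y"
    obtain k z where k: "P k" "\<forall>s\<le>c. k s = h s" "\<forall>s. c < s \<and> s \<le> d \<longrightarrow> norm (f s - k s) \<le> e"
        "\<forall>s\<ge>d. k s = z"
      using Q(1)[unfolded Q_def, rule_format, of h y] A Q(3,4) by auto
    obtain l w where l: "P l" "\<forall>s\<le>d. l s = k s" "\<forall>s. d < s \<and> s \<le> e' \<longrightarrow> norm (f s - l s) \<le> e"
        "\<forall>s\<ge>e'. l s = w"
      using Q(2)[unfolded Q_def, rule_format, of k z] k A Q(3,4) by auto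
    have "norm (f s - l s) \<le> e" if "c < s" "s \<le> e'" for s
      using k(3) l(2,3) that by (cases "s \<le> d") auto
    then show "\<exists>k z. P k \<and> (\<forall>s\<le>c. k s = h s) \<and> (\<forall>s. c < s \<and> s \<le> e' \<longrightarrow> norm (f s - k s) \<le> e) \<and>
        (\<forall>s\<ge>e'. k s = z)"
      using k(2) l \<open>c \<le> d\<close> by (intro exI[of _ l] exI[of _ w]) auto
  qed
  have Q_step: "Q c d" if "c < d" and l: "\<And>s. c < s \<Longrightarrow> s < d \<Longrightarrow> norm (f s - l) \<le> e" for c d l
    unfolding Q_def
  proof (intro impI allI, elim conjE)
    fix h y assume A: "a \<le> c" "d \<le> b" "P h" "\<forall>s\<ge>c. h s = y"
    \<comment> \<open>From \<open>c\<close> on, \<open>h\<close> equals \<open>y\<close>. The first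
      jump, effective only after \<open>c\<close>, moves the value to \<open>l\<close>; the second,
      effective at \<open>d\<close> itself, moves it to \<open>f d\<close>. Values up to
      \<open>c\<close> are untouched and the error at \<open>d\<close> is zero.\<close>
    let ?k = "\<lambda>t. h t + ((if c < t then l - y else 0) + (if d \<le> t then f d - l else 0))"
    have "P ?k"
      using A \<open>c < d\<close> by (intro add gt ge) auto
    then show "\<exists>k z. P k \<and> (\<forall>s\<le>c. k s = h s) \<and> (\<forall>s. c < s \<and> s \<le> d \<longrightarrow> norm (f s - k s) \<le> e) \<and>
        (\<forall>s\<ge>d. k s = z)"
      using A \<open>c < d\<close> l \<open>e > 0\<close> by (intro exI[of _ ?k] exI[of _ "f d"]) auto
  qed
  have left: "\<exists>d>0. \<forall>c. c \<le> x \<and> x - c < d \<longrightarrow> Q c x" if "x \<in> {a..b}" for x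
  proof (cases "x = a")
    \<comment> \<open>At \<open>a\<close> no left limit is available, but for \<open>c < a\<close>
      the claim \<open>Q c x\<close> is vacuous by its premise \<open>a \<le> c\<close>. At
      \<open>b\<close> the premise \<open>d \<le> b\<close> does the same on the right.\<close>
    case True
    then have "Q c x" if "c \<le> x" for c
      using Q_refl[of x] that by (cases "c = x") (auto simp: Q_def)
    then show ?thesis by (intro exI[of _ 1]) auto
  next
    case False
    then obtain l where "(f \<longlongrightarrow> l) (at_left x)"
      using assms(2) \<open>x \<in> {a..b}\<close> unfolding regulated_def by force
    then have "eventually (\<lambda>s. norm (f s - l) < e) (at_left x)"
      using \<open>e > 0\<close> by (simp add: tendsto_iff dist_norm)
    then obtain c0 where "c0 < x" and c0: "\<And>s. c0 < s \<Longrightarrow> s < x \<Longrightarrow> norm (f s - l) < e"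
      by (auto simp: eventually_at_left_field)
    have "Q c x" if "c \<le> x" "x - c < x - c0" for c
      using that Q_refl[of x] c0 by (cases "c = x") (auto intro!: Q_step[of _ _ l] less_imp_le)
    then show ?thesis
      using \<open>c0 < x\<close> by (intro exI[of _ "x - c0"]) auto
  qed
  have right: "\<exists>d>0. \<forall>c. x \<le> c \<and> c - x < d \<longrightarrow> Q x c" if "x \<in> {a..b}" for x
  proof (cases "x = b")
    case True
    then have "Q x c" if "x \<le> c" for c
      using Q_refl[of x] that by (cases "c = x") (auto simp: Q_def)
    then show ?thesis by (intro exI[of _ 1]) auto
  next
    case False
    then obtain l where "(f \<longlongrightarrow> l) (at_right x)"
      using assms(2) \<open>x \<in> {a..b}\<close> unfolding regulated_def by force
    then have "eventually (\<lambda>s. norm (f s - l) < e) (at_right x)"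
      using \<open>e > 0\<close> by (simp add: tendsto_iff dist_norm)
    then obtain c0 where "x < c0" and c0: "\<And>s. x < s \<Longrightarrow> s < c0 \<Longrightarrow> norm (f s - l) < e"
      by (auto simp: eventually_at_right_field)
    have "Q x c" if "x \<le> c" "c - x < c0 - x" for c
      using that Q_refl[of x] c0 by (cases "c = x") (auto intro!: Q_step[of _ _ l] less_imp_le)
    then show ?thesis
      using \<open>x < c0\<close> by (intro exI[of _ "c0 - x"]) auto
  qed
  have "Q a b"
    using assms(1)
  proof (induction rule: Bolzano)
    case (trans c d e')
    then show ?case by (rule Q_trans)
  next
    case (local x)
    obtain d1 where d1: "d1 > 0" "\<forall>c. c \<le> x \<and> x - c < d1 \<longrightarrow> Q c x"
      using left[of x] local by auto
    obtain d2 where d2: "d2 > 0" "\<forall>c. x \<le> c \<and> c - x < d2 \<longrightarrow> Q x c"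
      using right[of x] local by auto
    have "Q c d" if "c \<le> x" "x \<le> d" "d - c < min d1 d2" for c d
      using that d1(2) d2(2) by (intro Q_trans[of c x d]) auto
    then show ?case
      using d1(1) d2(1) by (intro exI[of _ "min d1 d2"]) auto
  qed
  \<comment> \<open>Starting approximant: constant \<open>f a\<close> from \<open>a\<close> on,
    hence exact at \<open>a\<close>; \<open>Q a b\<close> prolongs it to \<open>b\<close>.\<close>
  moreover have "P (\<lambda>t. if a \<le> t then f a else 0)"
    using \<open>a \<le> b\<close> by (intro ge) auto
  ultimately obtain k where k: "P k" "\<forall>s\<le>a. k s = (if a \<le> s then f a else 0)"
      "\<forall>s. a < s \<and> s \<le> b \<longrightarrow> norm (f s - k s) \<le> e"
    unfolding Q_def by force
  have "norm (f t - k t) \<le> e" if "t \<in> {a..b}" for t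
    using k(2,3) that \<open>e > 0\<close> by (cases "t = a") auto
  with k(1) show ?thesis by (rule that)
qed

section \<open>One-sided limits of dominated functions\<close>

text \<open>The monotone function \<open>v\<close> is bounded below on \<open>{s<..b}\<close>. Once
  \<open>v u\<close> is within \<open>e\<close> of its infimum there, all increments of
  \<open>v\<close> between \<open>s\<close> and \<open>u\<close> are below \<open>e\<close>, and
  those of \<open>f\<close> with them.\<close>

lemma dominated_right_limit:
  fixes f :: "real \<Rightarrow> 'b::banach" and v :: "real \<Rightarrow> real"
  assumes dom: "\<And>s t. a \<le> s \<Longrightarrow> s \<le> t \<Longrightarrow> t \<le> b \<Longrightarrow> norm (f t - f s) \<le> v t - v s"
    and s: "s \<in> {a..<b}"
  shows "\<exists>l. (f \<longlongrightarrow> l) (at_right s)"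
proof (rule tendsto_of_cauchy)
  fix e :: real assume "e > 0"
  have mono: "v x \<le> v y" if "a \<le> x" "x \<le> y" "y \<le> b" for x y
    using dom[OF that] norm_ge_zero[of "f y - f x"] by linarith
  let ?V = "v ` {s<..b}"
  have bdd: "bdd_below ?V"
    using mono s by (intro bdd_belowI[of _ "v a"]) auto
  have "?V \<noteq> {}" using s by auto
  then obtain u where u: "s < u" "u \<le> b" "v u < Inf ?V + e"
    using cInf_lessD[of ?V "Inf ?V + e"] \<open>e > 0\<close> by auto
  have *: "dist (f x) (f y) < e" if "s < x" "x < u" "s < y" "y < u" "x \<le> y" for x y
  proof -
    have "Inf ?V \<le> v x" using that u bdd by (intro cInf_lower) auto
    moreover have "v y \<le> v u" using that u s by (intro mono) auto
    moreover have "norm (f y - f x) \<le> v y - v x" using that u s by (intro dom) auto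
    ultimately show ?thesis using u(3) by (simp add: dist_norm norm_minus_commute)
  qed
  show "\<exists>P. eventually P (at_right s) \<and> (\<forall>x y. P x \<and> P y \<longrightarrow> dist (f x) (f y) < e)"
  proof (intro exI conjI allI impI)
    show "eventually (\<lambda>x. s < x \<and> x < u) (at_right s)"
      using u(1) by (auto simp: eventually_at_right_field)
    fix x y assume "(s < x \<and> x < u) \<and> (s < y \<and> y < u)"
    then show "dist (f x) (f y) < e"
      using *[of x y] *[of y x] by (cases "x \<le> y") (auto simp: dist_commute)
  qed
qed simp

lemma dominated_left_limit:
  fixes f :: "real \<Rightarrow> 'b::banach" and v :: "real \<Rightarrow> real"
  assumes dom: "\<And>s t. a \<le> s \<Longrightarrow> s \<le> t \<Longrightarrow> t \<le> b \<Longrightarrow> norm (f t - f s) \<le> v t - v s"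
    and s: "s \<in> {a<..b}"
  shows "\<exists>l. (f \<longlongrightarrow> l) (at_left s)"
proof -
  have "\<exists>l. ((\<lambda>t. f (- t)) \<longlongrightarrow> l) (at_right (- s))"
  \<comment> \<open>Reflection reverses the order, so \<open>v\<close> is negated as well to keep
    its increments nonnegative.\<close>
  proof (rule dominated_right_limit[of "- b" "- a" _ "\<lambda>t. - v (- t)"])
    fix x y assume "- b \<le> x" "x \<le> y" "y \<le> - a"
    then show "norm (f (- y) - f (- x)) \<le> - v (- y) - - v (- x)"
      using dom[of "- y" "- x"] by (simp add: norm_minus_commute)
  qed (use s in auto)
  then show ?thesis by (simp add: filterlim_at_left_to_right)
qed

section \<open>Integrals of jump functions\<close>

text \<open>The gauge \<open>\<bar>t - s\<bar>\<close> away from \<open>s\<close> forces the tag \<open>s\<close> on every interval that contains \<open>s\<close>.\<close>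

lemma delta_fine_forces_tag:
  assumes "delta_fine (\<lambda>t. if t = s then \<eta> else \<bar>t - s\<bar>) m \<alpha> \<tau>" "j < m"
    and "\<alpha> j \<le> s" "s \<le> \<alpha> (Suc j)"
  shows "\<tau> j = s" "s - \<eta> < \<alpha> j" "\<alpha> (Suc j) < s + \<eta>"
proof -
  have *: "{\<alpha> j..\<alpha> (Suc j)} \<subseteq> {\<tau> j - (if \<tau> j = s then \<eta> else \<bar>\<tau> j - s\<bar>)<..<
      \<tau> j + (if \<tau> j = s then \<eta> else \<bar>\<tau> j - s\<bar>)}"
    using assms(1,2) unfolding delta_fine_def by blast
  moreover have "s \<in> {\<alpha> j..\<alpha> (Suc j)}" using assms by auto
  ultimately have "s \<in> {\<tau> j - (if \<tau> j = s then \<eta> else \<bar>\<tau> j - s\<bar>)<..<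
      \<tau> j + (if \<tau> j = s then \<eta> else \<bar>\<tau> j - s\<bar>)}" by blast
  then show "\<tau> j = s" by (auto split: if_splits)
  with subsetD[OF *, of "\<alpha> j"] subsetD[OF *, of "\<alpha> (Suc j)"] assms(3,4)
  show "s - \<eta> < \<alpha> j" "\<alpha> (Suc j) < s + \<eta>" by auto
qed

lemma KS_sum_Suc:
  "KS_sum F g (Suc m) \<alpha> \<tau> = KS_sum F g m \<alpha> \<tau> + blinfun_apply (F (\<alpha> (Suc m)) - F (\<alpha> m)) (g (\<tau> m))"
  by (simp add: KS_sum_def)

text \<open>The interval in which \<open>s\<close> is passed has tag \<open>s\<close>, where the
  integrand is still 0. The later terms telescope to \<open>F b - F u\<close> with \<open>u\<close>
  just to the right of \<open>s\<close>, and \<open>F u\<close> is close to \<open>L\<close>. If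
  \<open>s = b\<close>, all terms vanish.\<close>

lemma has_KS_integral_jump_right:
  fixes F :: "real \<Rightarrow> 'a::real_normed_vector \<Rightarrow>\<^sub>L 'a"
  assumes s: "s \<in> {a..b}" and L: "s < b \<Longrightarrow> (F \<longlongrightarrow> L) (at_right s)"
  shows "has_KS_integral a b F (\<lambda>t. if s < t then x else 0)
    (if s < b then blinfun_apply (F b - L) x else 0)"
  unfolding has_KS_integral_def
proof (intro allI impI)
  fix \<epsilon> :: real assume "\<epsilon> > 0"
  \<comment> \<open>The summand 1 covers \<open>x = 0\<close> and makes
    \<open>e * norm x < \<epsilon>\<close> strict.\<close>
  define e where "e = \<epsilon> / (norm x + 1)"
  have "e > 0" using \<open>\<epsilon> > 0\<close> by (simp add: e_def add_nonneg_pos)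
  have e: "e * norm x < \<epsilon>"
    using \<open>\<epsilon> > 0\<close> add_nonneg_pos[OF norm_ge_zero[of x] zero_less_one] by (simp add: e_def field_simps)
  obtain \<eta> where "\<eta> > 0" and \<eta>: "\<And>u. s < b \<Longrightarrow> s < u \<Longrightarrow> u < s + \<eta> \<Longrightarrow> norm (F u - L) < e"
  proof (cases "s < b")
    case True
    then have "eventually (\<lambda>u. norm (F u - L) < e) (at_right s)"
      using L \<open>e > 0\<close> by (simp add: tendsto_iff dist_norm)
    then obtain c where "s < c" "\<And>u. s < u \<Longrightarrow> u < c \<Longrightarrow> norm (F u - L) < e"
      by (auto simp: eventually_at_right_field)
    then show ?thesis by (intro that[of "c - s"]) auto
  qed (use that[of 1] in auto)
  let ?\<delta> = "\<lambda>t. if t = s then \<eta> else \<bar>t - s\<bar>"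
  let ?g = "\<lambda>t. if s < t then x else 0"
  show "\<exists>\<delta>. is_gauge a b \<delta> \<and> (\<forall>m \<alpha> \<tau>. is_tagged_division a b m \<alpha> \<tau> \<and> delta_fine \<delta> m \<alpha> \<tau> \<longrightarrow>
      norm (KS_sum F ?g m \<alpha> \<tau> - (if s < b then blinfun_apply (F b - L) x else 0)) < \<epsilon>)"
  proof (intro exI[of _ ?\<delta>] conjI allI impI; (elim conjE)?)
    show "is_gauge a b ?\<delta>" using \<open>\<eta> > 0\<close> by (auto simp: is_gauge_def)
    fix m \<alpha> \<tau> assume div: "is_tagged_division a b m \<alpha> \<tau>" and fine: "delta_fine ?\<delta> m \<alpha> \<tau>"
    have ends: "\<alpha> 0 = a" "\<alpha> m = b"
      using div by (auto simp: is_tagged_division_def is_division_def)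
    \<comment> \<open>Invariant for partial sums: past \<open>s\<close>, each new term shifts the
      sum and its target \<open>(F (\<alpha> k) - L) x\<close> equally, so the error arises only in
      the interval where \<open>s\<close> is passed.\<close>
    have "(\<alpha> k \<le> s \<longrightarrow> KS_sum F ?g k \<alpha> \<tau> = 0) \<and>
        (s < \<alpha> k \<longrightarrow> norm (KS_sum F ?g k \<alpha> \<tau> - blinfun_apply (F (\<alpha> k) - L) x) \<le> e * norm x)"
      if "k \<le> m" for k
      using that
    proof (induction k)
      case 0
      then show ?case using s ends by (simp add: KS_sum_def)
    next
      case (Suc k)
      have tag: "\<alpha> k \<le> \<tau> k" "\<tau> k \<le> \<alpha> (Suc k)" and less: "\<alpha> k < \<alpha> (Suc k)"
        and le: "\<alpha> (Suc k) \<le> b"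
        using div Suc.prems is_division_in_interval[of a b m \<alpha> "Suc k"]
        by (auto simp: is_tagged_division_def is_division_def)
      consider "\<alpha> (Suc k) \<le> s" | "s < \<alpha> k" | "\<alpha> k \<le> s" "s < \<alpha> (Suc k)" by linarith
      then show ?case
      proof cases
        case 1
        then show ?thesis using Suc tag less by (simp add: KS_sum_Suc)
      next
        case 2
        then show ?thesis using Suc tag less
          by (simp add: KS_sum_Suc blinfun.diff_left algebra_simps)
      next
        case 3
        have "norm (F (\<alpha> (Suc k)) - L) \<le> e"
          using delta_fine_forces_tag(3)[OF fine, of k] Suc.prems 3 le by (intro less_imp_le \<eta>) auto
        then have "norm (blinfun_apply (F (\<alpha> (Suc k)) - L) x) \<le> e * norm x"
          by (meson mult_right_mono norm_blinfun norm_ge_zero order_trans)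
        then show ?thesis
          using delta_fine_forces_tag(1)[OF fine, of k] Suc 3
          by (simp add: KS_sum_Suc)
      qed
    qed
    from this[of m] show
      "norm (KS_sum F ?g m \<alpha> \<tau> - (if s < b then blinfun_apply (F b - L) x else 0)) < \<epsilon>"
      using ends s e \<open>\<epsilon> > 0\<close> by (cases "s < b") auto
  qed
qed

text \<open>Here the interval reaching \<open>s\<close> from the left has tag \<open>s\<close> and
  contributes in full, so the telescoping starts at its left end, where \<open>F\<close> is close to
  \<open>L\<close>. If \<open>s = a\<close>, it starts exactly at \<open>F a\<close>, whence
  \<open>L = F a\<close>.\<close>

lemma has_KS_integral_jump_left:
  fixes F :: "real \<Rightarrow> 'a::real_normed_vector \<Rightarrow>\<^sub>L 'a"
  assumes s: "s \<in> {a..b}" and L: "a < s \<Longrightarrow> (F \<longlongrightarrow> L) (at_left s)" "a = s \<Longrightarrow> L = F a"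
  shows "has_KS_integral a b F (\<lambda>t. if s \<le> t then x else 0) (blinfun_apply (F b - L) x)"
  unfolding has_KS_integral_def
proof (intro allI impI)
  fix \<epsilon> :: real assume "\<epsilon> > 0"
  define e where "e = \<epsilon> / (norm x + 1)"
  have "e > 0" using \<open>\<epsilon> > 0\<close> by (simp add: e_def add_nonneg_pos)
  have e: "e * norm x < \<epsilon>"
    using \<open>\<epsilon> > 0\<close> add_nonneg_pos[OF norm_ge_zero[of x] zero_less_one] by (simp add: e_def field_simps)
  obtain \<eta> where "\<eta> > 0" and \<eta>: "\<And>u. a < s \<Longrightarrow> s - \<eta> < u \<Longrightarrow> u < s \<Longrightarrow> norm (F u - L) < e"
  proof (cases "a < s")
    case True
    then have "eventually (\<lambda>u. norm (F u - L) < e) (at_left s)"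
      using L \<open>e > 0\<close> by (simp add: tendsto_iff dist_norm)
    then obtain c where "c < s" "\<And>u. c < u \<Longrightarrow> u < s \<Longrightarrow> norm (F u - L) < e"
      by (auto simp: eventually_at_left_field)
    then show ?thesis by (intro that[of "s - c"]) auto
  qed (use that[of 1] in auto)
  let ?\<delta> = "\<lambda>t. if t = s then \<eta> else \<bar>t - s\<bar>"
  let ?g = "\<lambda>t. if s \<le> t then x else 0"
  show "\<exists>\<delta>. is_gauge a b \<delta> \<and> (\<forall>m \<alpha> \<tau>. is_tagged_division a b m \<alpha> \<tau> \<and> delta_fine \<delta> m \<alpha> \<tau> \<longrightarrow>
      norm (KS_sum F ?g m \<alpha> \<tau> - blinfun_apply (F b - L) x) < \<epsilon>)"
  proof (intro exI[of _ ?\<delta>] conjI allI impI; (elim conjE)?)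
    show "is_gauge a b ?\<delta>" using \<open>\<eta> > 0\<close> by (auto simp: is_gauge_def)
    fix m \<alpha> \<tau> assume div: "is_tagged_division a b m \<alpha> \<tau>" and fine: "delta_fine ?\<delta> m \<alpha> \<tau>"
    have ends: "\<alpha> 0 = a" "\<alpha> m = b"
      using div by (auto simp: is_tagged_division_def is_division_def)
    have "(\<alpha> k < s \<longrightarrow> KS_sum F ?g k \<alpha> \<tau> = 0) \<and>
        (s \<le> \<alpha> k \<longrightarrow> norm (KS_sum F ?g k \<alpha> \<tau> - blinfun_apply (F (\<alpha> k) - L) x) \<le> e * norm x)"
      if "k \<le> m" for k
      using that
    proof (induction k)
      case 0
      then show ?case using s ends L(2) \<open>e > 0\<close> by (auto simp: KS_sum_def)
    next
      case (Suc k)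
      have tag: "\<alpha> k \<le> \<tau> k" "\<tau> k \<le> \<alpha> (Suc k)" and less: "\<alpha> k < \<alpha> (Suc k)"
        and le: "a \<le> \<alpha> k"
        using div Suc.prems is_division_in_interval[of a b m \<alpha> k]
        by (auto simp: is_tagged_division_def is_division_def)
      consider "\<alpha> (Suc k) < s" | "s \<le> \<alpha> k" | "\<alpha> k < s" "s \<le> \<alpha> (Suc k)" by linarith
      then show ?case
      proof cases
        case 1
        then show ?thesis using Suc tag less by (simp add: KS_sum_Suc)
      next
        case 2
        then show ?thesis using Suc tag less
          by (simp add: KS_sum_Suc blinfun.diff_left algebra_simps)
      next
        case 3
        have "norm (F (\<alpha> k) - L) \<le> e"
          using delta_fine_forces_tag(2)[OF fine, of k] Suc.prems 3 le by (intro less_imp_le \<eta>) auto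
        then have "norm (blinfun_apply (F (\<alpha> k) - L) x) \<le> e * norm x"
          by (meson mult_right_mono norm_blinfun norm_ge_zero order_trans)
        then show ?thesis
          using delta_fine_forces_tag(1)[OF fine, of k] Suc 3
          by (simp add: KS_sum_Suc blinfun.diff_left norm_minus_commute)
      qed
    qed
    from this[of m] show "norm (KS_sum F ?g m \<alpha> \<tau> - blinfun_apply (F b - L) x) < \<epsilon>"
      using ends s e by auto
  qed
qed

section \<open>Estimates of sums and integrability of regulated functions\<close>

lemma norm_KS_sum_le:
  assumes dom: "\<And>s t. a \<le> s \<Longrightarrow> s \<le> t \<Longrightarrow> t \<le> b \<Longrightarrow> norm (F t - F s) \<le> v t - v s"
    and div: "is_tagged_division a b m \<alpha> \<tau>"
  shows "norm (KS_sum F g m \<alpha> \<tau>) \<le> (\<Sum>j<m. (v (\<alpha> (Suc j)) - v (\<alpha> j)) * norm (g (\<tau> j)))"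
  unfolding KS_sum_def
proof (rule sum_norm_le)
  fix j assume "j \<in> {..<m}"
  then have "norm (F (\<alpha> (Suc j)) - F (\<alpha> j)) \<le> v (\<alpha> (Suc j)) - v (\<alpha> j)"
    using div is_division_in_interval[of a b m \<alpha> j] is_division_in_interval[of a b m \<alpha> "Suc j"]
    by (intro dom) (auto simp: is_tagged_division_def is_division_def less_imp_le)
  then show "norm (blinfun_apply (F (\<alpha> (Suc j)) - F (\<alpha> j)) (g (\<tau> j)))
      \<le> (v (\<alpha> (Suc j)) - v (\<alpha> j)) * norm (g (\<tau> j))"
    by (meson mult_right_mono norm_blinfun norm_ge_zero order_trans)
qed

lemma sum_increments_division:
  fixes v :: "real \<Rightarrow> real"
  assumes "is_division a b m \<alpha>"
  shows "(\<Sum>j<m. v (\<alpha> (Suc j)) - v (\<alpha> j)) = v b - v a"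
  using assms sum_lessThan_telescope[of "\<lambda>j. v (\<alpha> j)" m] by (simp add: is_division_def)

text \<open>Sums for a step function \<open>h\<close> near \<open>g\<close> converge, and sums for
  \<open>g\<close> and \<open>h\<close> differ by at most \<open>(v b - v a) * e\<close> on every
  tagged division. So the sums for \<open>g\<close> satisfy the Cauchy criterion.\<close>

lemma regulated_KS_integrable:
  fixes F :: "real \<Rightarrow> 'a::banach \<Rightarrow>\<^sub>L 'a"
  assumes "a \<le> b" "regulated a b g"
    and dom: "\<And>s t. a \<le> s \<Longrightarrow> s \<le> t \<Longrightarrow> t \<le> b \<Longrightarrow> norm (F t - F s) \<le> v t - v s"
  shows "KS_integrable a b F g"
proof -
  let ?S = "\<lambda>g (m, \<alpha>, \<tau>). KS_sum F g m \<alpha> \<tau>"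
  have mono: "v x \<le> v y" if "a \<le> x" "x \<le> y" "y \<le> b" for x y
    using dom[OF that] norm_ge_zero[of "F y - F x"] by linarith
  have "\<exists>J. (?S g \<longlongrightarrow> J) (KS_filter a b)"
  proof (rule tendsto_of_cauchy[OF KS_filter_neq_bot[OF assms(1)]])
    fix \<epsilon> :: real assume "\<epsilon> > 0"
    define e where "e = \<epsilon> / 4 / (v b - v a + 1)"
    have pos: "v b - v a + 1 > 0" using mono[of a b] assms(1) by simp
    then have "e > 0" using \<open>\<epsilon> > 0\<close> by (simp add: e_def)
    have e: "(v b - v a) * e \<le> \<epsilon> / 4"
      using \<open>\<epsilon> > 0\<close> pos by (simp add: e_def field_simps)
    obtain h where h: "KS_integrable a b F h" "\<And>t. t \<in> {a..b} \<Longrightarrow> norm (g t - h t) \<le> e"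
    proof (rule regulated_approximation[OF assms(1,2) \<open>e > 0\<close>, of "KS_integrable a b F"])
      show "KS_integrable a b F (\<lambda>t. h t + k t)" if "KS_integrable a b F h" "KS_integrable a b F k" for h k
        using that has_KS_integral_add unfolding KS_integrable_def by blast
      fix s x assume s: "s \<in> {a..b}"
      have "\<exists>L. s < b \<longrightarrow> (F \<longlongrightarrow> L) (at_right s)"
        using s dominated_right_limit[of a b F v s, OF dom] by (cases "s < b") auto
      then show "KS_integrable a b F (\<lambda>t. if s < t then x else 0)"
        unfolding KS_integrable_def using has_KS_integral_jump_right[OF s, of F] by blast
      have "\<exists>L. (a < s \<longrightarrow> (F \<longlongrightarrow> L) (at_left s)) \<and> (a = s \<longrightarrow> L = F a)"
        using s dominated_left_limit[of a b F v s, OF dom] by (cases "a < s") auto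
      then show "KS_integrable a b F (\<lambda>t. if s \<le> t then x else 0)"
        unfolding KS_integrable_def using has_KS_integral_jump_left[OF s, of F] by blast
    qed blast
    obtain J where "has_KS_integral a b F h J"
      using h(1) by (auto simp: KS_integrable_def)
    then have "eventually (\<lambda>p. dist (?S h p) J < \<epsilon> / 4) (KS_filter a b)"
      using \<open>\<epsilon> > 0\<close> unfolding has_KS_integral_iff_tendsto by (intro tendstoD) auto
    moreover have "eventually (\<lambda>p. norm (?S g p - ?S h p) \<le> \<epsilon> / 4) (KS_filter a b)"
      unfolding eventually_KS_filter
    \<comment> \<open>Any gauge will do, since the estimate does not depend on fineness.\<close>
    proof (intro exI[of _ "\<lambda>_. 1"] conjI allI impI, simp add: is_gauge_def, elim conjE)
      fix m \<alpha> \<tau> assume div: "is_tagged_division a b m \<alpha> \<tau>"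
      have "norm (KS_sum F (\<lambda>t. g t - h t) m \<alpha> \<tau>)
          \<le> (\<Sum>j<m. (v (\<alpha> (Suc j)) - v (\<alpha> j)) * norm (g (\<tau> j) - h (\<tau> j)))"
        using dom div by (rule norm_KS_sum_le)
      also have "\<dots> \<le> (\<Sum>j<m. (v (\<alpha> (Suc j)) - v (\<alpha> j)) * e)"
        using div is_division_in_interval[of a b m \<alpha>]
        by (intro sum_mono mult_left_mono h(2) is_tagged_division_tag_in_interval[OF div])
           (auto simp: is_tagged_division_def is_division_def less_imp_le intro!: mono)
      also have "\<dots> = (v b - v a) * e"
        using sum_increments_division[of a b m \<alpha> v] div
        by (simp add: is_tagged_division_def flip: sum_distrib_right)
      finally show "norm ((case (m, \<alpha>, \<tau>) of (m, \<alpha>, \<tau>) \<Rightarrow> KS_sum F g m \<alpha> \<tau>) -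
          (case (m, \<alpha>, \<tau>) of (m, \<alpha>, \<tau>) \<Rightarrow> KS_sum F h m \<alpha> \<tau>)) \<le> \<epsilon> / 4"
        using e by (simp add: KS_sum_diff)
    qed
    \<comment> \<open>\<open>J\<close> is the integral of \<open>h\<close>, not of \<open>g\<close>;
      it only serves as the centre of a ball of radius \<open>\<epsilon> / 2\<close> that contains
      eventually all sums for \<open>g\<close>.\<close>
    ultimately have "eventually (\<lambda>p. dist (?S g p) J < \<epsilon> / 2) (KS_filter a b)"
    proof eventually_elim
      case (elim p)
      have "dist (?S g p) J \<le> dist (?S g p) (?S h p) + dist (?S h p) J"
        by (rule dist_triangle)
      also have "\<dots> < \<epsilon> / 2"
        using elim by (simp add: dist_norm)
      finally show ?case .
    qed
    then show "\<exists>P. eventually P (KS_filter a b) \<and> (\<forall>x y. P x \<and> P y \<longrightarrow> dist (?S g x) (?S g y) < \<epsilon>)"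
      using dist_triangle_half_l by blast
  qed
  then show ?thesis by (simp add: KS_integrable_def has_KS_integral_iff_tendsto)
qed

section \<open>Measurability of superlevel sets\<close>

lemma regulated_diff:
  assumes "regulated a b f" "regulated a b g"
  shows "regulated a b (\<lambda>t. f t - g t)"
  using assms unfolding regulated_def by (fast intro: tendsto_diff)

lemma regulated_norm:
  assumes "regulated a b f"
  shows "regulated a b (\<lambda>t. norm (f t))"
  using assms unfolding regulated_def by (fast intro: tendsto_norm)

text \<open>On \<open>[a, b]\<close>, \<open>f\<close> is a uniform limit of Borel step functions
  \<open>h k\<close> with error \<open>1 / (k + 1)\<close>. Lowering the level by the same amount
  turns the set into a countable intersection of superlevel sets of the \<open>h k\<close>.\<close>

lemma regulated_superlevel_set_borel:
  fixes f :: "real \<Rightarrow> real"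
  assumes "a \<le> b" "regulated a b f"
  shows "{t \<in> {a..b}. c \<le> f t} \<in> sets borel"
proof -
  have "\<exists>h. h \<in> borel_measurable borel \<and> (\<forall>t\<in>{a..b}. norm (f t - h t) \<le> inverse (real (Suc k)))"
    for k
  proof (rule regulated_approximation[OF assms, of "inverse (real (Suc k))" "\<lambda>h. h \<in> borel_measurable borel"])
    fix h :: "real \<Rightarrow> real" assume "h \<in> borel_measurable borel"
      "\<And>t. t \<in> {a..b} \<Longrightarrow> norm (f t - h t) \<le> inverse (real (Suc k))"
    then show ?thesis by blast
  qed auto
  then obtain h where [measurable]: "\<And>k. h k \<in> borel_measurable borel"
    and h: "\<And>k t. t \<in> {a..b} \<Longrightarrow> norm (f t - h k t) \<le> inverse (real (Suc k))"
    by metis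
  have "c \<le> f t \<longleftrightarrow> (\<forall>k. c - inverse (real (Suc k)) \<le> h k t)" if "t \<in> {a..b}" for t
  proof
    assume "c \<le> f t"
    then have "c - inverse (real (Suc k)) \<le> h k t" for k
      using h[OF that, of k] by (simp add: abs_le_iff)
    then show "\<forall>k. c - inverse (real (Suc k)) \<le> h k t" ..
  next
    assume *: "\<forall>k. c - inverse (real (Suc k)) \<le> h k t"
    have "c - 2 * inverse (real (Suc k)) \<le> f t" for k
      using h[OF that, of k] *[rule_format, of k] by (simp add: abs_le_iff)
    moreover have "(\<lambda>k. c - 2 * inverse (real (Suc k))) \<longlonglongrightarrow> c - 2 * 0"
      by (intro tendsto_intros LIMSEQ_inverse_real_of_nat)
    ultimately show "c \<le> f t"
      by (intro LIMSEQ_le_const2[of _ c]) auto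
  qed
  then have "{t \<in> {a..b}. c \<le> f t} = {t \<in> {a..b}. \<forall>k. c - inverse (real (Suc k)) \<le> h k t}"
    by auto
  also have "\<dots> \<in> sets borel" by measurable
  finally show ?thesis .
qed

section \<open>Small increments of \<open>v\<close> on vanishing sets\<close>

text \<open>
  An Egorov-type estimate. The generalised inverse \<open>\<phi>\<close> of \<open>v\<close> maps the interval \<open>[v s, v t)\<close> into
  \<open>[s, t]\<close>, so the push-forward under \<open>\<phi>\<close> of Lebesgue measure on \<open>[v a, v b)\<close> dominates the
  increments of \<open>v\<close>, whatever the one-sided values of \<open>v\<close> at its jumps.
\<close>

lemma small_increments_on_vanishing_sets:
  fixes v :: "real \<Rightarrow> real" and A :: "nat \<Rightarrow> real set"
  assumes "a \<le> b"
    and mono: "\<And>s t. a \<le> s \<Longrightarrow> s \<le> t \<Longrightarrow> t \<le> b \<Longrightarrow> v s \<le> v t"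
    and A: "\<And>n. A n \<in> sets borel" "decseq A" "(\<Inter>n. A n) = {}"
    and "e > 0"
  shows "\<exists>N \<delta>. is_gauge a b \<delta> \<and> (\<forall>m \<alpha> \<tau>. is_tagged_division a b m \<alpha> \<tau> \<and> delta_fine \<delta> m \<alpha> \<tau> \<longrightarrow>
    (\<Sum>j | j < m \<and> \<tau> j \<in> A N. v (\<alpha> (Suc j)) - v (\<alpha> j)) < e)"
proof -
  \<comment> \<open>The alternative \<open>t = a\<close> keeps the set nonempty for
    \<open>y < v a\<close>, so \<phi> is monotone on the whole line and therefore Borel.\<close>
  define \<phi> where "\<phi> y = Sup {t \<in> {a..b}. t = a \<or> v t \<le> y}" for y
  have bdd: "bdd_above {t \<in> {a..b}. t = a \<or> v t \<le> y}" for y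
    by (rule bdd_aboveI[of _ b]) auto
  have ne: "{t \<in> {a..b}. t = a \<or> v t \<le> y} \<noteq> {}" for y
    using \<open>a \<le> b\<close> by auto
  have "mono \<phi>"
    unfolding \<phi>_def by (intro monoI cSup_subset_mono ne bdd) auto
  then have [measurable]: "\<phi> \<in> borel_measurable borel"
    by (rule borel_measurable_mono)
  have \<phi>_in: "\<phi> y \<in> {s..t}" if st: "a \<le> s" "s \<le> t" "t \<le> b" "y \<in> {v s..<v t}" for s t y
  proof -
    have "s \<le> \<phi> y"
      unfolding \<phi>_def using st by (intro cSup_upper bdd) auto
    moreover have "\<phi> y \<le> t"
      unfolding \<phi>_def
    proof (rule cSup_least[OF ne])
      fix x assume "x \<in> {t \<in> {a..b}. t = a \<or> v t \<le> y}"
      then show "x \<le> t" using st mono[of t x] by (cases "x \<le> t") auto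
    qed
    ultimately show ?thesis by simp
  qed
  \<comment> \<open>Half-open, like the blocks
    \<open>[v (\<alpha> j), v (\<alpha> (j + 1)))\<close>, which are then disjoint subsets of
    it.\<close>
  define \<nu> where "\<nu> = restrict_space lborel {v a..<v b}"
  define \<mu> where "\<mu> = distr \<nu> borel \<phi>"
  have \<phi>_meas [measurable]: "\<phi> \<in> borel_measurable \<nu>"
    unfolding \<nu>_def by (intro measurable_restrict_space1) simp
  have "finite_measure \<nu>"
    by (rule finite_measureI) (auto simp: \<nu>_def space_restrict_space emeasure_restrict_space mono \<open>a \<le> b\<close>)
  then interpret \<mu>: finite_measure \<mu>
    unfolding \<mu>_def by (rule finite_measure.finite_measure_distr) simp
  have sets_\<mu> [simp]: "sets \<mu> = sets borel" by (simp add: \<mu>_def)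
  have "(\<lambda>n. measure \<mu> (A n)) \<longlonglongrightarrow> measure \<mu> (\<Inter>n. A n)"
    using A by (intro \<mu>.finite_Lim_measure_decseq) auto
  then have "(\<lambda>n. measure \<mu> (A n)) \<longlonglongrightarrow> 0" using A(3) by simp
  then have "eventually (\<lambda>n. measure \<mu> (A n) < e) sequentially"
    using \<open>e > 0\<close> by (rule order_tendstoD)
  then obtain N where "measure \<mu> (A N) < e"
    by (auto simp: eventually_sequentially)
  then have "emeasure \<mu> (A N) < ennreal e"
    using \<open>e > 0\<close> by (simp add: \<mu>.emeasure_eq_measure ennreal_lessI)
  moreover have "emeasure \<mu> (A N) = (INF U\<in>{U. A N \<subseteq> U \<and> open U}. emeasure \<mu> U)"
    by (rule outer_regular) (use A in auto)
  ultimately obtain U where U: "A N \<subseteq> U" "open U" "emeasure \<mu> U < ennreal e"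
    by (auto simp: INF_less_iff)
  then have U_less: "measure \<mu> U < e"
    using \<open>e > 0\<close> by (simp add: \<mu>.emeasure_eq_measure ennreal_less_iff)
  have "\<exists>d>0. ball t d \<subseteq> U" if "t \<in> A N" for t
    using U that by (meson openE subsetD)
  then obtain d where d: "\<And>t. t \<in> A N \<Longrightarrow> d t > 0" "\<And>t. t \<in> A N \<Longrightarrow> ball t (d t) \<subseteq> U"
    by metis
  \<comment> \<open>Intervals tagged in \<open>A N\<close> are confined to \<open>U\<close>; at
    other tags any positive value will do.\<close>
  let ?\<delta> = "\<lambda>t. if t \<in> A N then d t else 1"
  have "(\<Sum>j | j < m \<and> \<tau> j \<in> A N. v (\<alpha> (Suc j)) - v (\<alpha> j)) < e"
    if div: "is_tagged_division a b m \<alpha> \<tau>" and fine: "delta_fine ?\<delta> m \<alpha> \<tau>" for m \<alpha> \<tau>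
  proof -
    let ?T = "{j. j < m \<and> \<tau> j \<in> A N}"
    let ?I = "\<lambda>j. {v (\<alpha> j)..<v (\<alpha> (Suc j))}"
    have div': "is_division a b m \<alpha>" using div by (simp add: is_tagged_division_def)
    have v\<alpha>: "v (\<alpha> i) \<le> v (\<alpha> j)" if "i \<le> j" "j \<le> m" for i j
      using is_division_mono[OF div' that] is_division_in_interval[OF div', of i]
        is_division_in_interval[OF div', of j] that by (intro mono) auto
    have ends: "\<alpha> 0 = a" "\<alpha> m = b" using div' by (auto simp: is_division_def)
    \<comment> \<open>\<phi> maps the block of \<open>v\<close>-values over
      \<open>[\<alpha> j, \<alpha> (j + 1)]\<close> into that interval, which lies in
      \<open>U\<close> by fineness.\<close>
    have sub: "?I j \<subseteq> \<phi> -` U \<inter> space \<nu>" if "j \<in> ?T" for j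
    proof
      fix y assume y: "y \<in> ?I j"
      have "y \<in> space \<nu>"
        using y v\<alpha>[of 0 j] v\<alpha>[of "Suc j" m] that ends by (auto simp: \<nu>_def space_restrict_space)
      have "\<phi> y \<in> {\<alpha> j..\<alpha> (Suc j)}"
        using that y is_division_in_interval[OF div', of j] is_division_in_interval[OF div', of "Suc j"]
          is_division_mono[OF div', of j "Suc j"] by (intro \<phi>_in) auto
      also have "\<dots> \<subseteq> {\<tau> j - ?\<delta> (\<tau> j)<..<\<tau> j + ?\<delta> (\<tau> j)}"
        using fine that unfolding delta_fine_def by blast
      also have "\<dots> = ball (\<tau> j) (d (\<tau> j))"
        using that by (simp add: ball_eq_greaterThanLessThan)
      also have "\<dots> \<subseteq> U" using that d(2) by auto
      finally show "y \<in> \<phi> -` U \<inter> space \<nu>" using \<open>y \<in> space \<nu>\<close> by simp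
    qed
    have disj: "disjoint_family_on ?I ?T"
      unfolding disjoint_family_on_def
    proof (intro ballI impI)
      fix i j assume "i \<in> ?T" "j \<in> ?T" "i \<noteq> j"
      then show "?I i \<inter> ?I j = {}"
        using v\<alpha>[of "Suc i" j] v\<alpha>[of "Suc j" i] by (cases "i < j") auto
    qed
    \<comment> \<open>The increments are the lengths of disjoint blocks inside the preimage of
      \<open>U\<close>, so their sum is at most \<open>measure \<mu> U\<close>.\<close>
    have "(\<Sum>j\<in>?T. v (\<alpha> (Suc j)) - v (\<alpha> j)) = (\<Sum>j\<in>?T. measure lborel (?I j))"
      using v\<alpha> by (intro sum.cong) auto
    also have "\<dots> = measure lborel (\<Union>j\<in>?T. ?I j)"
      using disj v\<alpha> by (intro measure_finite_Union[symmetric]) auto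
    also have "\<dots> = measure \<nu> (\<Union>j\<in>?T. ?I j)"
      unfolding \<nu>_def
    proof (rule measure_restrict_space[symmetric])
      have "(\<Union>j\<in>?T. ?I j) \<subseteq> space \<nu>" using sub by blast
      then show "(\<Union>j\<in>?T. ?I j) \<subseteq> {v a..<v b}" by (simp add: \<nu>_def space_restrict_space)
    qed simp
    also have "\<dots> \<le> measure \<nu> (\<phi> -` U \<inter> space \<nu>)"
      using sub U(2) \<open>finite_measure \<nu>\<close>
      by (intro finite_measure.finite_measure_mono measurable_sets[OF \<phi>_meas]) auto
    also have "\<dots> = measure \<mu> U"
      unfolding \<mu>_def using U(2) by (intro measure_distr[symmetric]) auto
    finally show ?thesis using U_less by simp
  qed
  moreover have "is_gauge a b ?\<delta>" using d(1) by (auto simp: is_gauge_def)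
  ultimately show ?thesis by blast
qed

section \<open>Bounded convergence of the integrals\<close>

theorem theorem6p3:
  fixes F :: "real \<Rightarrow> 'a::banach \<Rightarrow>\<^sub>L 'a"
    and g :: "real \<Rightarrow> 'a" and gs :: "nat \<Rightarrow> real \<Rightarrow> 'a"
    and a b K :: real
  assumes "a < b"
    and "bounded_variation a b F"
    and "regulated a b g"
    and "\<And>n. regulated a b (gs n)"
    and "\<And>t. t \<in> {a..b} \<Longrightarrow> (\<lambda>n. gs n t) \<longlonglongrightarrow> g t"
    and "\<And>n. sup_norm a b (gs n) \<le> ereal K"
  shows "KS_integrable a b F g
    \<and> (\<forall>n. KS_integrable a b F (gs n))
    \<and> (\<lambda>n. KS_integral a b F (gs n)) \<longlonglongrightarrow> KS_integral a b F g"
proof -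
  have "a \<le> b" using \<open>a < b\<close> by simp
  obtain v where dom: "\<And>s t. a \<le> s \<Longrightarrow> s \<le> t \<Longrightarrow> t \<le> b \<Longrightarrow> norm (F t - F s) \<le> v t - v s"
    using bounded_variation_dominated[OF assms(2)] by blast
  have mono: "v s \<le> v t" if "a \<le> s" "s \<le> t" "t \<le> b" for s t
    using dom[OF that] norm_ge_zero[of "F t - F s"] by linarith
  have int: "KS_integrable a b F g" "\<And>n. KS_integrable a b F (gs n)"
    using assms(3,4) dom by (auto intro!: regulated_KS_integrable[OF \<open>a \<le> b\<close>])
  obtain J where J: "has_KS_integral a b F g J"
    using int(1) by (auto simp: KS_integrable_def)
  obtain Js where Js: "\<And>n. has_KS_integral a b F (gs n) (Js n)"
    using int(2) unfolding KS_integrable_def by metis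
  have gs_le: "norm (gs n t) \<le> K" if "t \<in> {a..b}" for n t
  proof -
    have "ereal (norm (gs n t)) \<le> sup_norm a b (gs n)"
      unfolding sup_norm_def using that by (rule SUP_upper)
    also have "\<dots> \<le> ereal K" by (rule assms(6))
    finally show ?thesis by simp
  qed
  have "norm (g t) \<le> K" if "t \<in> {a..b}" for t
    using tendsto_norm[OF assms(5)[OF that]] gs_le[OF that] by (intro LIMSEQ_le_const2) auto
  then have diff_le: "norm (gs n t - g t) \<le> 2 * K" if "t \<in> {a..b}" for n t
    using norm_triangle_ineq4[of "gs n t" "g t"] gs_le[OF that, of n] that by fastforce
  have "K \<ge> 0"
    using order_trans[OF norm_ge_zero gs_le[of a 0]] \<open>a < b\<close> by simp
  have "Js \<longlonglongrightarrow> J"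
    unfolding LIMSEQ_iff
  proof (intro allI impI)
    fix \<epsilon> :: real assume "\<epsilon> > 0"
    \<comment> \<open>\<open>e\<close> has two roles: threshold for
      \<open>norm (gs n t - g t)\<close> and bound for the total increment of \<open>v\<close> over
      the intervals with exceptional tags. The summand 1 keeps the denominator positive.\<close>
    define e where "e = \<epsilon> / 2 / (v b - v a + 2 * K + 1)"
    have pos: "v b - v a + 2 * K + 1 > 0" using mono[of a b] \<open>a < b\<close> \<open>K \<ge> 0\<close> by simp
    then have "e > 0" using \<open>\<epsilon> > 0\<close> by (simp add: e_def)
    have e: "(v b - v a) * e + 2 * K * e < \<epsilon>"
    proof -
      have "(v b - v a) * e + 2 * K * e \<le> (v b - v a + 2 * K + 1) * e"
        using \<open>e > 0\<close> by (simp add: algebra_simps)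
      also have "\<dots> = \<epsilon> / 2" unfolding e_def using pos
        by (subst times_divide_eq_right, subst nonzero_mult_div_cancel_left) auto
      finally show ?thesis using \<open>\<epsilon> > 0\<close> by simp
    qed
    \<comment> \<open>The union over all \<open>n \<ge> k\<close> makes the sets decrease and lets
      one gauge serve every \<open>n \<ge> N\<close>.\<close>
    define A where "A k = (\<Union>n\<in>{k..}. {t \<in> {a..b}. e \<le> norm (gs n t - g t)})" for k
    have "{t \<in> {a..b}. e \<le> norm (gs n t - g t)} \<in> sets borel" for n
      by (intro regulated_superlevel_set_borel regulated_norm regulated_diff assms(3,4) \<open>a \<le> b\<close>)
    then have "A k \<in> sets borel" for k
      unfolding A_def by (intro sets.countable_UN') auto
    moreover have "decseq A"
      unfolding A_def decseq_def by force
    moreover have "(\<Inter>k. A k) = {}"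
    proof (rule ccontr)
      assume "(\<Inter>k. A k) \<noteq> {}"
      then obtain t where t: "\<And>k. t \<in> A k" by auto
      then have "t \<in> {a..b}" by (auto simp: A_def)
      then obtain k where "\<forall>n\<ge>k. norm (gs n t - g t) < e"
        using assms(5) \<open>e > 0\<close> unfolding LIMSEQ_iff by blast
      then show False using t[of k] by (auto simp: A_def)
    qed
    ultimately obtain N \<delta> where \<delta>: "is_gauge a b \<delta>" and
      small: "\<And>m \<alpha> \<tau>. is_tagged_division a b m \<alpha> \<tau> \<Longrightarrow> delta_fine \<delta> m \<alpha> \<tau> \<Longrightarrow>
        (\<Sum>j | j < m \<and> \<tau> j \<in> A N. v (\<alpha> (Suc j)) - v (\<alpha> j)) < e"
      using small_increments_on_vanishing_sets[of a b v A e] mono \<open>a \<le> b\<close> \<open>e > 0\<close> by blast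
    have "norm (Js n - J) < \<epsilon>" if "n \<ge> N" for n
    proof -
      let ?h = "\<lambda>t. gs n t - g t"
      have bound: "norm (KS_sum F ?h m \<alpha> \<tau>) \<le> (v b - v a) * e + 2 * K * e"
        if div: "is_tagged_division a b m \<alpha> \<tau>" and fine: "delta_fine \<delta> m \<alpha> \<tau>" for m \<alpha> \<tau>
      proof -
        let ?D = "\<lambda>j. v (\<alpha> (Suc j)) - v (\<alpha> j)"
        have div': "is_division a b m \<alpha>" using div by (simp add: is_tagged_division_def)
        have D: "?D j \<ge> 0" if "j < m" for j
          using that is_division_in_interval[OF div', of j] is_division_in_interval[OF div', of "Suc j"]
            is_division_mono[OF div', of j "Suc j"] mono[of "\<alpha> j" "\<alpha> (Suc j)"] by auto
        have "norm (KS_sum F ?h m \<alpha> \<tau>) \<le> (\<Sum>j<m. ?D j * norm (?h (\<tau> j)))"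
          using dom div by (rule norm_KS_sum_le)
        \<comment> \<open>The term with \<open>e\<close> is kept for exceptional tags too, so that
          the first part telescopes over the whole division.\<close>
        also have "\<dots> \<le> (\<Sum>j<m. ?D j * e + (if \<tau> j \<in> A N then ?D j * (2 * K) else 0))"
        proof (rule sum_mono)
          fix j assume "j \<in> {..<m}"
          then have j: "j < m" "\<tau> j \<in> {a..b}"
            using is_tagged_division_tag_in_interval[OF div] by auto
          show "?D j * norm (?h (\<tau> j)) \<le> ?D j * e + (if \<tau> j \<in> A N then ?D j * (2 * K) else 0)"
          proof (cases "\<tau> j \<in> A N")
            case True
            have "?D j * norm (?h (\<tau> j)) \<le> ?D j * (2 * K)"
              using D j diff_le by (intro mult_left_mono) auto
            moreover have "?D j * e \<ge> 0" using D j \<open>e > 0\<close> by simp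
            ultimately show ?thesis using True by simp
          next
            case False
            then have "norm (?h (\<tau> j)) \<le> e"
              using j \<open>n \<ge> N\<close> by (force simp: A_def)
            then show ?thesis using False D j by (simp add: mult_left_mono)
          qed
        qed
        also have "\<dots> = (\<Sum>j<m. ?D j) * e + (\<Sum>j | j < m \<and> \<tau> j \<in> A N. ?D j) * (2 * K)"
          by (simp add: sum.distrib sum_distrib_right sum.If_cases Int_def lessThan_def)
        also have "\<dots> \<le> (v b - v a) * e + 2 * K * e"
          using small[OF div fine] \<open>K \<ge> 0\<close> sum_increments_division[OF div', of v]
          by (simp add: mult.commute mult_left_mono)
        finally show ?thesis .
      qed
      \<comment> \<open>The bound passes to the limit along the filter, so no gauge adapted to the
        single \<open>gs n\<close> has to be chosen.\<close>
      have "((\<lambda>p. norm (case p of (m, \<alpha>, \<tau>) \<Rightarrow> KS_sum F ?h m \<alpha> \<tau>)) \<longlongrightarrow> norm (Js n - J)) (KS_filter a b)"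
        using has_KS_integral_diff[OF Js J] unfolding has_KS_integral_iff_tendsto
        by (rule tendsto_norm)
      moreover have "eventually (\<lambda>p. norm (case p of (m, \<alpha>, \<tau>) \<Rightarrow> KS_sum F ?h m \<alpha> \<tau>)
          \<le> (v b - v a) * e + 2 * K * e) (KS_filter a b)"
        unfolding eventually_KS_filter using \<delta> bound by auto
      ultimately have "norm (Js n - J) \<le> (v b - v a) * e + 2 * K * e"
        using KS_filter_neq_bot[OF \<open>a \<le> b\<close>] by (rule tendsto_upperbound)
      then show ?thesis using e by simp
    qed
    then show "\<exists>N. \<forall>n\<ge>N. norm (Js n - J) < \<epsilon>" by blast
  qed
  then show ?thesis
    using int by (simp add: KS_integral_eqI[OF \<open>a \<le> b\<close> J] KS_integral_eqI[OF \<open>a \<le> b\<close> Js])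
qed

end
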